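(* Let $X$ be a Hilbert space and let $T\in LR(X)$ be Hermitian. If $T$ is bounded, then $T$ is bounded both from below and from above. In addition, the converse holds in the case that $D(T)$ is dense in $X$: if $D(T)$ is dense in $X$ and $T$ is bounded both from below and from above, then $T$ is bounded.
   Context: $LR(X)$ is the set of all linear subspaces of $X\times X$. For $T\in LR(X)$: $D(T)$ is its domain, $T(x)=\{y:(x,y)\in T\}$. $T$ is Hermitian if $\langle y_2,x_1\rangle=\langle x_2,y_1\rangle$ for all $(x_1,y_1),(x_2,y_2)\in T$. A Hermitian $T$ is bounded from below (above) if there is $C\in\mathbf R$ with $\langle y,x\rangle\ge C\|x\|^2$ ($\langle y,x\rangle\le C\|x\|^2$) for all $(x,y)\in T$. $\tilde T_s$ is the single-valued linear operator from $D(T)$ to the normed quotient space $X/\overline{T(0)}$ (norm $\|[y]\|=\inf\{\|y-e\|:e\in\overline{T(0)}\}$) given by $\tilde T_s(x)=[y]=y+\overline{T(0)}$ for any $y\in T(x)$. The norm of $T$ is $\|T\|:=\sup\{\|\tilde T_s(x)\|:x\in D(T),\ \|x\|\le1\}$, and $T$ is bounded if $\|T\|<\infty$. *)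

theory Defs
  imports "HOL-Analysis.Analysis"
begin

section \<open>Real and complex scalars\<close>

text \<open>
  Hilbert spaces over the reals and over the complex numbers are treated uniformly. A
  \<open>real_normed_field\<close> with an additive map \<open>scnj\<close> such that \<open>x * scnj x = \<bar>x\<bar>\<^sup>2\<close> is a copy of the
  reals with the identity or of the complex numbers with complex conjugation.
\<close>

class rc_field = real_normed_field +
  fixes scnj :: "'a \<Rightarrow> 'a"
  assumes scnj_add: "scnj (x + y) = scnj x + scnj y"
    and mult_scnj: "x * scnj x = (norm x)\<^sup>2 *\<^sub>R 1"

instantiation real :: rc_field
begin
definition scnj_real :: "real \<Rightarrow> real" where "scnj_real x = x"
instance by standard (simp_all add: scnj_real_def power2_eq_square)
end

instantiation complex :: rc_field
begin
definition scnj_complex :: "complex \<Rightarrow> complex" where "scnj_complex = cnj"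
instance by standard (simp_all add: scnj_complex_def scaleR_conv_of_real complex_norm_square
      del: of_real_power)
end

section \<open>Hilbert spaces\<close>

text \<open>
  Completeness is part of the sort \<open>banach\<close> of the underlying space; the locale says that its norm
  is the one induced by the inner product \<open>ip\<close>, which is linear in the first argument.
\<close>

locale hilbert_space = vector_space smul
  for smul :: "'k::rc_field \<Rightarrow> 'a::banach \<Rightarrow> 'a" +
  fixes ip :: "'a \<Rightarrow> 'a \<Rightarrow> 'k"
  assumes scale_of_real: "smul (of_real r) x = r *\<^sub>R x"
    and ip_add_left: "ip (x + y) z = ip x z + ip y z"
    and ip_scale_left: "ip (smul c x) y = c * ip x y"
    and ip_commute: "ip x y = scnj (ip y x)"
    and ip_self: "ip x x = of_real ((norm x)\<^sup>2)"

lemma hilbert_space_real_inner: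
  "hilbert_space (scaleR :: real \<Rightarrow> 'a \<Rightarrow> 'a::{real_inner,banach}) (\<bullet>)"
  by standard (simp_all add: scnj_real_def algebra_simps inner_commute power2_norm_eq_inner)

lemma hilbert_space_complex: "hilbert_space ((*) :: complex \<Rightarrow> complex \<Rightarrow> complex) (\<lambda>x y. x * cnj y)"
  by standard (simp_all add: scnj_complex_def algebra_simps scaleR_conv_of_real complex_norm_square
      del: of_real_power)

section \<open>Linear relations\<close>

text \<open>
  For a relation \<open>T\<close>, the domain is \<open>Domain T\<close> and the image of a point \<open>x\<close> is \<open>T `` {x}\<close>.
\<close>

definition LR :: "('k::field \<Rightarrow> 'a::ab_group_add \<Rightarrow> 'a) \<Rightarrow> ('a \<times> 'a) set set" where
  "LR smul = {T. module.subspace (module_prod.scale smul smul) T}"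

definition hermitian :: "('a \<Rightarrow> 'a \<Rightarrow> 'k) \<Rightarrow> ('a \<times> 'a) set \<Rightarrow> bool" where
  "hermitian ip T \<longleftrightarrow> (\<forall>(x1, y1)\<in>T. \<forall>(x2, y2)\<in>T. ip y2 x1 = ip x2 y1)"

text \<open>
  The inequalities between \<open>ip y x\<close> and a real number include that \<open>ip y x\<close> is real, which is
  automatic for a Hermitian relation.
\<close>

definition bounded_from_below ::
    "('a::real_normed_vector \<Rightarrow> 'a \<Rightarrow> 'k::rc_field) \<Rightarrow> ('a \<times> 'a) set \<Rightarrow> bool" where
  "bounded_from_below ip T \<longleftrightarrow>
    (\<exists>C::real. \<forall>(x, y)\<in>T. \<exists>r::real. ip y x = of_real r \<and> r \<ge> C * (norm x)\<^sup>2)"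

definition bounded_from_above ::
    "('a::real_normed_vector \<Rightarrow> 'a \<Rightarrow> 'k::rc_field) \<Rightarrow> ('a \<times> 'a) set \<Rightarrow> bool" where
  "bounded_from_above ip T \<longleftrightarrow>
    (\<exists>C::real. \<forall>(x, y)\<in>T. \<exists>r::real. ip y x = of_real r \<and> r \<le> C * (norm x)\<^sup>2)"

section \<open>The norm of a linear relation\<close>

text \<open>
  Elements of the quotient of the space by a subspace \<open>E\<close> are represented as cosets \<open>y +o E\<close>.
\<close>

definition coset_norm :: "'a::real_normed_vector set \<Rightarrow> real" where
  "coset_norm Q = (INF z\<in>Q. norm z)"

lemma coset_norm_eq:
  fixes E :: "'a::real_normed_vector set"
  assumes "\<And>e. e \<in> E \<Longrightarrow> - e \<in> E"
  shows "coset_norm (y +o E) = (INF e\<in>E. norm (y - e))"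
proof -
  have "y +o E = (\<lambda>e. y - e) ` E"
    using assms by (force simp: elt_set_plus_def image_iff)
  then show ?thesis by (simp add: coset_norm_def image_image)
qed

definition single_valued_part ::
    "('a::real_normed_vector \<times> 'a) set \<Rightarrow> 'a \<Rightarrow> 'a set" where
  "single_valued_part T x = (THE Q. \<exists>y\<in>T `` {x}. Q = y +o closure (T `` {0}))"

definition relation_norm :: "('a::real_normed_vector \<times> 'a) set \<Rightarrow> ereal" where
  "relation_norm T =
    (SUP x\<in>{x \<in> Domain T. norm x \<le> 1}. ereal (coset_norm (single_valued_part T x)))"

definition relation_bounded :: "('a::real_normed_vector \<times> 'a) set \<Rightarrow> bool" where
  "relation_bounded T \<longleftrightarrow> relation_norm T < \<infinity>"

lemma subspace_closure_normed:
  fixes S :: "'a::real_normed_vector set"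
  assumes S: "subspace S"
  shows "subspace (closure S)"
  unfolding subspace_def
proof (intro conjI ballI allI)
  show "0 \<in> closure S"
    using subspace_0[OF S] closure_subset by blast
  fix a assume "a \<in> closure S"
  then obtain f where f: "\<And>n. f n \<in> S" "f \<longlonglongrightarrow> a"
    unfolding closure_sequential by blast
  show "c *\<^sub>R a \<in> closure S" for c
    unfolding closure_sequential
    by (rule exI[of _ "\<lambda>n. c *\<^sub>R f n"]) (auto intro!: subspace_scale[OF S] tendsto_intros f)
  fix b assume "b \<in> closure S"
  then obtain g where g: "\<And>n. g n \<in> S" "g \<longlonglongrightarrow> b"
    unfolding closure_sequential by blast
  show "a + b \<in> closure S"
    unfolding closure_sequential
    by (rule exI[of _ "\<lambda>n. f n + g n"]) (auto intro!: subspace_add[OF S] tendsto_intros f g)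
qed

context hilbert_space
begin

lemma LR_iff:
  "T \<in> LR smul \<longleftrightarrow> (0, 0) \<in> T \<and>
    (\<forall>x y x' y'. (x, y) \<in> T \<longrightarrow> (x', y') \<in> T \<longrightarrow> (x + x', y + y') \<in> T) \<and>
    (\<forall>c x y. (x, y) \<in> T \<longrightarrow> (smul c x, smul c y) \<in> T)"
proof -
  interpret P: vector_space_prod smul smul ..
  show ?thesis
    unfolding LR_def P.p.subspace_def mem_Collect_eq zero_prod_def Ball_def split_paired_All
      P.scale_prod plus_prod_def fst_conv snd_conv
    by blast
qed

lemma single_valued_part_eq:
  assumes T: "T \<in> LR smul" and xy: "(x, y) \<in> T"
  shows "single_valued_part T x = y +o closure (T `` {0})"
proof -
  let ?E = "closure (T `` {0})"
  have neg: "(- a, - b) \<in> T" if "(a, b) \<in> T" for a b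
    using that T scale_minus_left[of 1] unfolding LR_iff by (metis scale_one)
  have add: "(a + a', b + b') \<in> T" if "(a, b) \<in> T" "(a', b') \<in> T" for a b a' b'
    using that T unfolding LR_iff by blast
  have "Real_Vector_Spaces.subspace (T `` {0})"
    unfolding real_vector.subspace_def
  proof (intro conjI ballI allI)
    show "0 \<in> T `` {0}" using T by (auto simp: LR_iff)
    show "a + b \<in> T `` {0}" if "a \<in> T `` {0}" "b \<in> T `` {0}" for a b
      using that add[of 0 a 0 b] by auto
    show "c *\<^sub>R a \<in> T `` {0}" if "a \<in> T `` {0}" for c a
    proof -
      have "(smul (of_real c) 0, smul (of_real c) a) \<in> T"
        using that T unfolding LR_iff by blast
      then show ?thesis by (simp add: scale_of_real)
    qed
  qed
  then have E: "Real_Vector_Spaces.subspace ?E" by (rule subspace_closure_normed)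
  have "y' +o ?E = y +o ?E" if "(x, y') \<in> T" for y'
  proof -
    have "(x + - x, y' + - y) \<in> T" by (intro add neg that xy)
    then have "y' - y \<in> T `` {0}" by simp
    then have d: "y' - y \<in> ?E" by (rule closure_subset[THEN subsetD])
    have "z - y' \<in> ?E \<longleftrightarrow> z - y \<in> ?E" for z
    proof
      assume "z - y' \<in> ?E"
      from real_vector.subspace_add[OF E this d] show "z - y \<in> ?E" by simp
    next
      assume "z - y \<in> ?E"
      from real_vector.subspace_diff[OF E this d] show "z - y' \<in> ?E" by simp
    qed
    moreover have "u +o ?E = {z. z - u \<in> ?E}" for u
      unfolding elt_set_plus_def by (auto intro!: bexI[of _ "_ - u"])
    ultimately show ?thesis by simp
  qed
  then have "Q = y +o ?E" if "\<exists>y'\<in>T `` {x}. Q = y' +o ?E" for Q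
    using that by blast
  moreover have "\<exists>y'\<in>T `` {x}. y +o ?E = y' +o ?E"
    using xy by blast
  ultimately show ?thesis
    unfolding single_valued_part_def by (rule the_equality[rotated])
qed

end

end

theory Submission
  imports Defs
begin

text \<open>
  Write \<open>q(x) = \<langle>y, x\<rangle>\<close> for \<open>(x, y) \<in> T\<close>. Since \<open>T\<close> is Hermitian, \<open>\<langle>y, x\<rangle>\<close> is its own conjugate, so it
  equals its real part, and by polarization the real part of the inner product is an expression in
  the norm alone (\<open>re_ip\<close>). Hence both boundedness conditions together say that
  \<open>\<bar>q(x)\<bar> \<le> K \<parallel>x\<parallel>\<^sup>2\<close>, and all estimates below are estimates about real numbers, whichever of the two
  scalar fields is used.

  \<^emph>\<open>A bounded relation has a bounded form.\<close> The Hermitian identity makes \<open>T(0)\<close> orthogonal to the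
  domain, so \<open>q(x) = re_ip (y - e) x\<close> for every \<open>e \<in> T(0)\<close>. For a unit vector \<open>x\<close> this gives
  \<open>\<bar>q(x)\<bar> \<le> \<parallel>y - e\<parallel> + 1\<close>, where \<open>e\<close> may range over the closure of \<open>T(0)\<close> by continuity; so
  \<open>\<bar>q(x)\<bar> \<le> \<parallel>T\<parallel> + 1\<close> (\<open>abs_re_ip_le_coset_norm\<close>). The general case follows because \<open>q\<close> is
  homogeneous of degree two.

  \<^emph>\<open>A bounded form on a dense domain gives a bounded relation.\<close> This is the argument that the norm
  of a self-adjoint operator is determined by its quadratic form. For \<open>(x, y), (u, v) \<in> T\<close> the
  Hermitian identity gives \<open>q(x + u) - q(x - u) = 4 Re \<langle>y, u\<rangle>\<close>, so that
  \<open>4 Re \<langle>y, u\<rangle> \<le> 2 K (\<parallel>x\<parallel>\<^sup>2 + \<parallel>u\<parallel>\<^sup>2)\<close> (\<open>re_ip_le_of_form_bound\<close>). Here \<open>v\<close> no longer occurs, and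
  both sides are continuous in \<open>u\<close>; by density the inequality holds for all \<open>u\<close>, in particular
  for \<open>u = y / K\<close>, where it yields \<open>\<parallel>y\<parallel> \<le> K \<parallel>x\<parallel>\<close> (\<open>norm_le_of_form_bound\<close>). The coset of \<open>y\<close> has
  norm at most \<open>\<parallel>y\<parallel>\<close>, so \<open>\<parallel>T\<parallel> \<le> K\<close>.
\<close>

section \<open>The real part of the inner product\<close>

text \<open>
  The polarization formula for the real part of the inner product. Defining it through the norm
  makes its continuity evident and gives it real values whatever the scalar field.
\<close>

definition re_ip :: "'a::real_normed_vector \<Rightarrow> 'a \<Rightarrow> real" where
  "re_ip x y = ((norm (x + y))\<^sup>2 - (norm (x - y))\<^sup>2) / 4"

lemma re_ip_scaleR_scaleR: "re_ip (c *\<^sub>R x) (c *\<^sub>R y) = c\<^sup>2 * re_ip x y"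
  unfolding re_ip_def
  by (simp flip: scaleR_add_right scaleR_diff_right add: power_mult_distrib right_diff_distrib)

lemma re_ip_self_scaleR: "re_ip x (c *\<^sub>R x) = c * (norm x)\<^sup>2"
proof -
  have "x + c *\<^sub>R x = (1 + c) *\<^sub>R x" "x - c *\<^sub>R x = (1 - c) *\<^sub>R x"
    by (simp_all add: algebra_simps)
  then have "re_ip x (c *\<^sub>R x) = ((1 + c)\<^sup>2 * (norm x)\<^sup>2 - (1 - c)\<^sup>2 * (norm x)\<^sup>2) / 4"
    by (simp add: re_ip_def power_mult_distrib)
  also have "\<dots> = c * (norm x)\<^sup>2"
    by (simp add: power2_eq_square field_simps)
  finally show ?thesis .
qed

text \<open>
  A crude substitute for the Cauchy--Schwarz inequality, obtained from the triangle inequality by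
  factoring the difference of squares in the polarization formula.
\<close>

lemma abs_re_ip_le: "\<bar>re_ip x y\<bar> \<le> (norm x + norm y) * norm y"
proof -
  have "x + y = (x - y) + 2 *\<^sub>R y" by (simp add: scaleR_2)
  then have "\<bar>norm (x + y) - norm (x - y)\<bar> \<le> norm (2 *\<^sub>R y)"
    using norm_triangle_ineq3[of "x + y" "x - y"] by (simp add: scaleR_2)
  moreover have "norm (x + y) + norm (x - y) \<le> 2 * (norm x + norm y)"
    using norm_triangle_ineq[of x y] norm_triangle_ineq4[of x y] by simp
  ultimately have "(norm (x + y) + norm (x - y)) * \<bar>norm (x + y) - norm (x - y)\<bar>
      \<le> (2 * (norm x + norm y)) * (2 * norm y)"
    by (intro mult_mono) auto
  moreover have "4 * \<bar>re_ip x y\<bar> = \<bar>(norm (x + y) + norm (x - y)) * (norm (x + y) - norm (x - y))\<bar>"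
    by (simp add: re_ip_def power2_eq_square algebra_simps)
  moreover have "\<dots> = (norm (x + y) + norm (x - y)) * \<bar>norm (x + y) - norm (x - y)\<bar>"
    unfolding abs_mult by simp
  ultimately show ?thesis
    by linarith
qed

context hilbert_space
begin

lemma ip_add_right: "ip z (x + y) = ip z x + ip z y"
  using ip_commute[of z "x + y"] ip_commute[of z x] ip_commute[of z y]
  by (simp add: ip_add_left scnj_add)

lemma ip_diff_left: "ip (x - y) z = ip x z - ip y z"
  using ip_add_left[of "x - y" y z] by simp

lemma ip_diff_right: "ip z (x - y) = ip z x - ip z y"
  using ip_add_right[of z "x - y" y] by simp

lemma ip_zero_left: "ip 0 z = 0"
  using ip_diff_left[of 0 0 z] by simp

lemma ip_zero_right: "ip z 0 = 0"
  using ip_diff_right[of z 0 0] by simp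

lemma of_real_re_ip: "of_real (re_ip x y) = (ip x y + ip y x) / 2"
proof -
  have "of_real (re_ip x y) = (ip (x + y) (x + y) - ip (x - y) (x - y)) / 4"
    by (simp only: re_ip_def ip_self of_real_divide of_real_diff of_real_numeral)
  also have "\<dots> = (ip x y + ip y x) / 2"
    by (simp add: ip_add_left ip_add_right ip_diff_left ip_diff_right)
  finally show ?thesis .
qed

lemma parallelogram:
  fixes x y :: 'a
  shows "(norm (x + y))\<^sup>2 + (norm (x - y))\<^sup>2 = 2 * ((norm x)\<^sup>2 + (norm y)\<^sup>2)"
proof -
  have "(of_real ((norm (x + y))\<^sup>2 + (norm (x - y))\<^sup>2) :: 'k)
      = ip (x + y) (x + y) + ip (x - y) (x - y)"
    by (simp only: ip_self of_real_add)
  also have "\<dots> = 2 * (ip x x + ip y y)"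
    by (simp add: ip_add_left ip_add_right ip_diff_left ip_diff_right)
  also have "\<dots> = of_real (2 * ((norm x)\<^sup>2 + (norm y)\<^sup>2))"
    by (simp only: ip_self of_real_add of_real_mult of_real_numeral)
  finally show ?thesis by (simp only: of_real_eq_iff)
qed

section \<open>The quadratic form of a Hermitian relation\<close>

lemma LR_add: "T \<in> LR smul \<Longrightarrow> (x, y) \<in> T \<Longrightarrow> (u, v) \<in> T \<Longrightarrow> (x + u, y + v) \<in> T"
  unfolding LR_iff by blast

lemma LR_scaleR:
  assumes "T \<in> LR smul" "(x, y) \<in> T"
  shows "(c *\<^sub>R x, c *\<^sub>R y) \<in> T"
  using assms unfolding LR_iff scale_of_real[symmetric] by blast

lemma LR_diff:
  assumes "T \<in> LR smul" "(x, y) \<in> T" "(u, v) \<in> T"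
  shows "(x - u, y - v) \<in> T"
  using LR_add[OF assms(1,2) LR_scaleR[OF assms(1,3), of "-1"]] by simp

lemma zero_in_closure_multivalued_part: "T \<in> LR smul \<Longrightarrow> 0 \<in> closure (T `` {0})"
  unfolding LR_iff by (rule subsetD[OF closure_subset]) simp

lemma hermitianD: "hermitian ip T \<Longrightarrow> (x, y) \<in> T \<Longrightarrow> (u, v) \<in> T \<Longrightarrow> ip v x = ip u y"
  unfolding hermitian_def by blast

lemma hermitian_ip_eq_re_ip:
  assumes "hermitian ip T" "(x, y) \<in> T"
  shows "ip y x = of_real (re_ip y x)"
  using hermitianD[OF assms assms(2)] by (simp add: of_real_re_ip)

text \<open>
  The two-sided condition is stated with a single positive constant because the density argument
  later divides by it.
\<close>

lemma bounded_from_below_and_above_iff: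
  assumes "hermitian ip T"
  shows "bounded_from_below ip T \<and> bounded_from_above ip T \<longleftrightarrow>
    (\<exists>K>0. \<forall>(x, y)\<in>T. \<bar>re_ip y x\<bar> \<le> K * (norm x)\<^sup>2)"
proof
  assume "bounded_from_below ip T \<and> bounded_from_above ip T"
  then obtain C D where
    C: "\<And>x y. (x, y) \<in> T \<Longrightarrow> \<exists>r. ip y x = of_real r \<and> C * (norm x)\<^sup>2 \<le> r" and
    D: "\<And>x y. (x, y) \<in> T \<Longrightarrow> \<exists>r. ip y x = of_real r \<and> r \<le> D * (norm x)\<^sup>2"
    unfolding bounded_from_below_def bounded_from_above_def by blast
  define K where "K = 1 + \<bar>C\<bar> + \<bar>D\<bar>"
  have "\<bar>re_ip y x\<bar> \<le> K * (norm x)\<^sup>2" if xy: "(x, y) \<in> T" for x y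
  proof -
    have "C * (norm x)\<^sup>2 \<le> re_ip y x" "re_ip y x \<le> D * (norm x)\<^sup>2"
      using C[OF xy] D[OF xy] by (auto simp: hermitian_ip_eq_re_ip[OF assms xy])
    moreover have "- K * (norm x)\<^sup>2 \<le> C * (norm x)\<^sup>2" "D * (norm x)\<^sup>2 \<le> K * (norm x)\<^sup>2"
      unfolding K_def by (intro mult_right_mono; simp)+
    ultimately show ?thesis by linarith
  qed
  moreover have "K > 0" unfolding K_def by simp
  ultimately show "\<exists>K>0. \<forall>(x, y)\<in>T. \<bar>re_ip y x\<bar> \<le> K * (norm x)\<^sup>2"
    by blast
next
  assume "\<exists>K>0. \<forall>(x, y)\<in>T. \<bar>re_ip y x\<bar> \<le> K * (norm x)\<^sup>2"
  then obtain K where K: "\<And>x y. (x, y) \<in> T \<Longrightarrow> \<bar>re_ip y x\<bar> \<le> K * (norm x)\<^sup>2"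
    by blast
  have "ip y x = of_real (re_ip y x) \<and> re_ip y x \<ge> - K * (norm x)\<^sup>2"
    "ip y x = of_real (re_ip y x) \<and> re_ip y x \<le> K * (norm x)\<^sup>2" if "(x, y) \<in> T" for x y
    using K[OF that] hermitian_ip_eq_re_ip[OF assms that] by auto
  then show "bounded_from_below ip T \<and> bounded_from_above ip T"
    unfolding bounded_from_below_def bounded_from_above_def by blast
qed

section \<open>Bounded relations have a bounded form\<close>

text \<open>The multivalued part \<open>T(0)\<close> is orthogonal to the domain, so the form does not see it.\<close>

lemma re_ip_diff_multivalued_part:
  assumes herm: "hermitian ip T" and xy: "(x, y) \<in> T" and e: "(0, e) \<in> T"
  shows "re_ip (y - e) x = re_ip y x"
proof -
  have "ip e x = 0" "ip x e = 0"
    using hermitianD[OF herm xy e] hermitianD[OF herm e xy]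
    by (simp_all add: ip_zero_left ip_zero_right)
  then have "of_real (re_ip (y - e) x) = (of_real (re_ip y x) :: 'k)"
    unfolding of_real_re_ip by (simp add: ip_diff_left ip_diff_right)
  then show ?thesis by (simp only: of_real_eq_iff)
qed

lemma abs_re_ip_le_coset_norm:
  assumes T: "T \<in> LR smul" and herm: "hermitian ip T" and xy: "(x, y) \<in> T" and x: "norm x = 1"
  shows "\<bar>re_ip y x\<bar> \<le> coset_norm (single_valued_part T x) + 1"
proof -
  let ?S = "{e. \<bar>re_ip y x\<bar> - 1 \<le> norm (y + e)}"
  have "T `` {0} \<subseteq> ?S"
  proof
    fix e assume "e \<in> T `` {0}"
    then have "(0, - e) \<in> T"
      using LR_scaleR[OF T, of 0 e "-1"] by simp
    from re_ip_diff_multivalued_part[OF herm xy this] abs_re_ip_le[of "y - - e" x]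
    show "e \<in> ?S" by (simp add: x)
  qed
  moreover have "closed ?S"
    by (intro closed_Collect_le continuous_intros)
  ultimately have "closure (T `` {0}) \<subseteq> ?S"
    by (rule closure_minimal)
  then have "\<bar>re_ip y x\<bar> - 1 \<le> norm z" if "z \<in> y +o closure (T `` {0})" for z
    using that by (auto simp: elt_set_plus_def)
  moreover have "y +o closure (T `` {0}) \<noteq> {}"
    using zero_in_closure_multivalued_part[OF T] by (auto simp: elt_set_plus_def)
  ultimately have "\<bar>re_ip y x\<bar> - 1 \<le> coset_norm (y +o closure (T `` {0}))"
    unfolding coset_norm_def by (intro cINF_greatest)
  then show ?thesis
    by (simp add: single_valued_part_eq[OF T xy])
qed

lemma form_bound_of_relation_bounded:
  assumes T: "T \<in> LR smul" and herm: "hermitian ip T" and bdd: "relation_bounded T"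
  shows "\<exists>K>0. \<forall>(x, y)\<in>T. \<bar>re_ip y x\<bar> \<le> K * (norm x)\<^sup>2"
proof -
  obtain M where M: "relation_norm T < ereal M"
    using bdd less_PInf_Ex_of_nat[of "relation_norm T"] unfolding relation_bounded_def by auto
  define K where "K = \<bar>M\<bar> + 1"
  have unit: "\<bar>re_ip y x\<bar> \<le> K" if xy: "(x, y) \<in> T" and x: "norm x = 1" for x y
  proof -
    have "ereal (coset_norm (single_valued_part T x)) \<le> relation_norm T"
      unfolding relation_norm_def using xy x by (intro SUP_upper) auto
    also note M
    finally have "coset_norm (single_valued_part T x) < M" by simp
    with abs_re_ip_le_coset_norm[OF T herm xy x] show ?thesis
      unfolding K_def by linarith
  qed
  have "\<bar>re_ip y x\<bar> \<le> K * (norm x)\<^sup>2" if xy: "(x, y) \<in> T" for x y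
  proof (cases "x = 0")
    case True
    then show ?thesis by (simp add: re_ip_def)
  next
    case False
    define c where "c = inverse (norm x)"
    have "\<bar>re_ip (c *\<^sub>R y) (c *\<^sub>R x)\<bar> \<le> K"
      using False by (intro unit LR_scaleR[OF T xy]) (simp add: c_def)
    then show ?thesis
      using False by (simp add: re_ip_scaleR_scaleR abs_mult c_def field_simps)
  qed
  moreover have "K > 0" by (simp add: K_def)
  ultimately show ?thesis by blast
qed

section \<open>Bounded forms on a dense domain\<close>

text \<open>
  Polarization of the form: since \<open>\<langle>v, x\<rangle> = \<langle>u, y\<rangle>\<close>, the difference of the form at \<open>x + u\<close> and at
  \<open>x - u\<close> is \<open>4 Re \<langle>y, u\<rangle>\<close>. The value \<open>v\<close> of the relation at \<open>u\<close> is absent from the conclusion, which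
  is what lets \<open>u\<close> leave the domain by density.
\<close>

lemma re_ip_le_of_form_bound:
  assumes T: "T \<in> LR smul" and herm: "hermitian ip T"
    and K: "\<And>x y. (x, y) \<in> T \<Longrightarrow> \<bar>re_ip y x\<bar> \<le> K * (norm x)\<^sup>2"
    and xy: "(x, y) \<in> T" and uv: "(u, v) \<in> T"
  shows "2 * re_ip y u \<le> K * ((norm x)\<^sup>2 + (norm u)\<^sup>2)"
proof -
  note plus = LR_add[OF T xy uv] and minus = LR_diff[OF T xy uv]
  have "of_real (re_ip (y + v) (x + u) - re_ip (y - v) (x - u))
      = ip (y + v) (x + u) - ip (y - v) (x - u)"
    by (simp add: hermitian_ip_eq_re_ip[OF herm plus] hermitian_ip_eq_re_ip[OF herm minus])
  also have "\<dots> = 2 * (ip y u + ip u y)"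
    using hermitianD[OF herm xy uv]
    by (simp add: ip_add_left ip_add_right ip_diff_left ip_diff_right)
  also have "\<dots> = of_real (4 * re_ip y u)"
    by (simp add: of_real_re_ip)
  finally have "4 * re_ip y u = re_ip (y + v) (x + u) - re_ip (y - v) (x - u)"
    by (simp only: of_real_eq_iff)
  also have "\<dots> \<le> K * (norm (x + u))\<^sup>2 + K * (norm (x - u))\<^sup>2"
    using K[OF plus] K[OF minus] by linarith
  also have "\<dots> = 2 * (K * ((norm x)\<^sup>2 + (norm u)\<^sup>2))"
    unfolding distrib_left[symmetric] parallelogram by (rule mult.left_commute)
  finally show ?thesis by simp
qed

lemma norm_le_of_form_bound:
  assumes T: "T \<in> LR smul" and herm: "hermitian ip T" and dense: "closure (Domain T) = UNIV"
    and "K > 0" and K: "\<And>x y. (x, y) \<in> T \<Longrightarrow> \<bar>re_ip y x\<bar> \<le> K * (norm x)\<^sup>2"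
    and xy: "(x, y) \<in> T"
  shows "norm y \<le> K * norm x"
proof -
  let ?S = "{u. 2 * re_ip y u \<le> K * ((norm x)\<^sup>2 + (norm u)\<^sup>2)}"
  have "Domain T \<subseteq> ?S"
    using re_ip_le_of_form_bound[OF T herm K xy] by blast
  moreover have "closed ?S"
    unfolding re_ip_def by (intro closed_Collect_le continuous_intros) auto
  ultimately have "closure (Domain T) \<subseteq> ?S"
    by (rule closure_minimal)
  then have all: "2 * re_ip y u \<le> K * ((norm x)\<^sup>2 + (norm u)\<^sup>2)" for u
    using dense by blast
  \<comment> \<open>The factor \<open>1 / K\<close> maximizes \<open>2 t - K t\<^sup>2\<close>, the coefficient of \<open>\<parallel>y\<parallel>\<^sup>2\<close> at \<open>u = t y\<close>.\<close>
  have "2 * ((1 / K) * (norm y)\<^sup>2) \<le> K * ((norm x)\<^sup>2 + (norm ((1 / K) *\<^sub>R y))\<^sup>2)"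
    using all[of "(1 / K) *\<^sub>R y"] unfolding re_ip_self_scaleR .
  then have "(norm y)\<^sup>2 \<le> (K * norm x)\<^sup>2"
    using \<open>K > 0\<close> by (simp add: power2_eq_square field_simps)
  then show ?thesis
    using \<open>K > 0\<close> by (auto intro: power2_le_imp_le)
qed

lemma coset_norm_single_valued_part_le:
  assumes T: "T \<in> LR smul" and xy: "(x, y) \<in> T"
  shows "coset_norm (single_valued_part T x) \<le> norm y"
proof -
  have "y \<in> y +o closure (T `` {0})"
    using set_plus_intro2[OF zero_in_closure_multivalued_part[OF T], of y] by simp
  moreover have "bdd_below (norm ` (y +o closure (T `` {0})))"
    by (rule bdd_belowI[of _ 0]) auto
  ultimately show ?thesis
    unfolding single_valued_part_eq[OF T xy] coset_norm_def by (intro cINF_lower)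
qed

lemma relation_bounded_of_form_bound:
  assumes T: "T \<in> LR smul" and herm: "hermitian ip T" and dense: "closure (Domain T) = UNIV"
    and "K > 0" and K: "\<And>x y. (x, y) \<in> T \<Longrightarrow> \<bar>re_ip y x\<bar> \<le> K * (norm x)\<^sup>2"
  shows "relation_bounded T"
proof -
  have "coset_norm (single_valued_part T x) \<le> K" if "x \<in> Domain T" and x: "norm x \<le> 1" for x
  proof -
    from \<open>x \<in> Domain T\<close> obtain y where xy: "(x, y) \<in> T" by blast
    note coset_norm_single_valued_part_le[OF T xy]
    also have "norm y \<le> K * norm x"
      by (rule norm_le_of_form_bound[OF T herm dense \<open>K > 0\<close> K xy])
    also have "\<dots> \<le> K"
      using x \<open>K > 0\<close> by (simp add: mult_left_le)
    finally show ?thesis .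
  qed
  then have "relation_norm T \<le> ereal K"
    unfolding relation_norm_def by (intro SUP_least) auto
  then show ?thesis
    unfolding relation_bounded_def by (auto intro: le_less_trans)
qed

end

section \<open>Boundedness and semiboundedness\<close>

theorem theorem3p5:
  fixes smul :: "'k::rc_field \<Rightarrow> 'a::banach \<Rightarrow> 'a"
    and ip :: "'a \<Rightarrow> 'a \<Rightarrow> 'k"
    and T :: "('a \<times> 'a) set"
  assumes "hilbert_space smul ip"
    and "T \<in> LR smul"
    and "hermitian ip T"
  shows "(relation_bounded T \<longrightarrow> bounded_from_below ip T \<and> bounded_from_above ip T) \<and>
    (closure (Domain T) = UNIV \<and> bounded_from_below ip T \<and> bounded_from_above ip T
      \<longrightarrow> relation_bounded T)"
proof -
  interpret hilbert_space smul ip by fact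
  note iff = bounded_from_below_and_above_iff[OF assms(3)]
  show ?thesis
  proof (intro conjI[of "_ \<longrightarrow> _"] impI)
    assume "relation_bounded T"
    then show "bounded_from_below ip T \<and> bounded_from_above ip T"
      unfolding iff by (rule form_bound_of_relation_bounded[OF assms(2,3)])
  next
    assume *: "closure (Domain T) = UNIV \<and> bounded_from_below ip T \<and> bounded_from_above ip T"
    then obtain K where "K > 0" "\<And>x y. (x, y) \<in> T \<Longrightarrow> \<bar>re_ip y x\<bar> \<le> K * (norm x)\<^sup>2"
      using iff by blast
    then show "relation_bounded T"
      using relation_bounded_of_form_bound[OF assms(2,3)] * by blast
  qed
qed

end
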